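(* Let $H=(V,E)$ be a directed $m$-uniform hypergraph. Let $H_1,H_2,\dots,H_p$ be directed spanning subhypergraphs of $H$ (each with vertex set $V$) whose edge sets $E(H_1),\dots,E(H_p)$ form a partition of $E$ into $p$ parts. Then $$\lambda_{\max}^Z(A_H)\le\sum_{i=1}^p\lambda_{\max}^Z(A_{H_i}).$$
   Context: $M_{m,n}$ is the set of real hypermatrices (tensors) $A=(a_{i_1i_2\dots i_m})$, $1\le i_1,\dots,i_m\le n$. For a vector $x$, $Ax^{m-1}$ is the vector with $i$-th entry $\sum_{i_2,\dots,i_m=1}^n a_{ii_2\dots i_m}x_{i_2}\cdots x_{i_m}$. For nonzero $A$, a pair $(\lambda,x)\in\mathbb R\times(\mathbb R^n\setminus\{0\})$ is a $Z$-eigenpair ($\lambda$ a $Z$-eigenvalue) if $Ax^{m-1}=\lambda x$ and $\sum_i x_i^2=1$. $\lambda_{\max}^Z(A)$ denotes the maximum $Z$-eigenvalue of $A$. A directed hypergraph $H=(V,E)$ has a finite vertex set $V=\{v_1,\dots,v_n\}$ and a set $E$ of edges; each edge $e$ is a subset of $V$ with a partition $e=T_e\sqcup H_e$ into a nonempty tail $T_e$ and a nonempty head $H_e$, and distinct edges $e_1\ne e_2$ satisfy $T_{e_1}\cup H_{e_1}\neq T_{e_2}\cup H_{e_2}$. It is $m$-uniform if $|e|=m$ for all $e\in E$. Edges of a subhypergraph keep the tails and heads they have in $H$. For a directed $m$-uniform hypergraph, $A_H=A_H^++A_H^-$, where: Out-adjacency hypermatrix $A_H^+=(a^+_{i_1\dots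 i_m})\in M_{m,n}$: for each edge $e$ with $|T_e|=k$, $a^+_{i_1\dots i_m}=\frac{1}{(m-k)!\,(k-1)!}$ whenever $(v_{i_1},\dots,v_{i_k})$ is an ordering of all the elements of $T_e$ and $(v_{i_{k+1}},\dots,v_{i_m})$ is an ordering of all the elements of $H_e$; all other entries are $0$. In-adjacency hypermatrix $A_H^-=(a^-_{i_1\dots i_m})\in M_{m,n}$: for each edge $e$ with $|T_e|=k$, $a^-_{i_1\dots i_m}=\frac{1}{(m-k-1)!\,k!}$ whenever $(v_{i_1},\dots,v_{i_{m-k}})$ is an ordering of all the elements of $H_e$ and $(v_{i_{m-k+1}},\dots,v_{i_m})$ is an ordering of all the elements of $T_e$; all other entries are $0$. *)

theory Defs
  imports "HOL-Analysis.Analysis" "HOL-Combinatorics.Multiset_Permutations"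
begin

section \<open>Hypermatrices and Z-eigenvalues\<close>

text \<open>
  A hypermatrix of order \<open>m\<close> and dimension \<open>n = CARD('n)\<close> is a function on index lists
  \<open>[i\<^sub>1, \<dots>, i\<^sub>m]\<close>; only its values on lists of length \<open>m\<close> matter.
\<close>

type_synonym 'n hypermatrix = "'n list \<Rightarrow> real"

definition nonzero_hypermatrix :: "nat \<Rightarrow> 'n hypermatrix \<Rightarrow> bool" where
  "nonzero_hypermatrix m A \<longleftrightarrow> (\<exists>is. length is = m \<and> A is \<noteq> 0)"

definition hm_apply :: "nat \<Rightarrow> 'n::finite hypermatrix \<Rightarrow> real ^ 'n \<Rightarrow> real ^ 'n" where
  "hm_apply m A x = (\<chi> i. \<Sum>is | length is = m - 1. A (i # is) * (\<Prod>j\<leftarrow>is. x $ j))"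

definition Z_eigenpair :: "nat \<Rightarrow> 'n::finite hypermatrix \<Rightarrow> real \<Rightarrow> real ^ 'n \<Rightarrow> bool" where
  "Z_eigenpair m A l x \<longleftrightarrow>
     nonzero_hypermatrix m A \<and> x \<noteq> 0 \<and> hm_apply m A x = l *\<^sub>R x \<and> (\<Sum>i\<in>UNIV. (x $ i)\<^sup>2) = 1"

definition Z_eigenvalue :: "nat \<Rightarrow> 'n::finite hypermatrix \<Rightarrow> real \<Rightarrow> bool" where
  "Z_eigenvalue m A l \<longleftrightarrow> (\<exists>x. Z_eigenpair m A l x)"

text \<open>
  \<open>Greatest\<close> rather than \<open>Max\<close>, because the latter is meaningful for finite sets only;
  the value is unspecified if there is no largest Z-eigenvalue.
\<close>

definition max_Z_eigenvalue :: "nat \<Rightarrow> 'n::finite hypermatrix \<Rightarrow> real" where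
  "max_Z_eigenvalue m A = (GREATEST l. Z_eigenvalue m A l)"


section \<open>Directed hypergraphs\<close>

text \<open>An edge is the pair of its tail and its head.\<close>

type_synonym 'v dedge = "'v set \<times> 'v set"

record 'v dhypergraph =
  verts :: "'v set"
  edges :: "'v dedge set"

definition edge_set :: "'v dedge \<Rightarrow> 'v set" where
  "edge_set e = fst e \<union> snd e"

definition dhypergraph :: "'v dhypergraph \<Rightarrow> bool" where
  "dhypergraph H \<longleftrightarrow>
     finite (verts H) \<and>
     (\<forall>(T, D)\<in>edges H. T \<noteq> {} \<and> D \<noteq> {} \<and> T \<inter> D = {} \<and> T \<union> D \<subseteq> verts H) \<and>
     (\<forall>e1\<in>edges H. \<forall>e2\<in>edges H. e1 \<noteq> e2 \<longrightarrow> edge_set e1 \<noteq> edge_set e2)"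

definition uniform_dhypergraph :: "nat \<Rightarrow> 'v dhypergraph \<Rightarrow> bool" where
  "uniform_dhypergraph m H \<longleftrightarrow> dhypergraph H \<and> (\<forall>e\<in>edges H. card (edge_set e) = m)"

definition spanning_subhypergraph :: "'v dhypergraph \<Rightarrow> 'v dhypergraph \<Rightarrow> bool" where
  "spanning_subhypergraph G H \<longleftrightarrow> dhypergraph G \<and> verts G = verts H \<and> edges G \<subseteq> edges H"


section \<open>Adjacency hypermatrices\<close>

text \<open>
  The function \<open>v\<close> enumerates the vertices by the index type. An index list determines the vertex
  set of a matching edge, and distinct edges have distinct vertex sets; so at most one summand
  below is nonzero, and the sum over the edges is just the entry contributed by that edge.
\<close>

definition out_adj :: "nat \<Rightarrow> ('n \<Rightarrow> 'v) \<Rightarrow> 'v dhypergraph \<Rightarrow> 'n hypermatrix" where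
  "out_adj m v H is =
     (\<Sum>(T, D)\<in>edges H. let k = card T in
        if take k (map v is) \<in> permutations_of_set T \<and> drop k (map v is) \<in> permutations_of_set D
        then 1 / (fact (m - k) * fact (k - 1)) else 0)"

definition in_adj :: "nat \<Rightarrow> ('n \<Rightarrow> 'v) \<Rightarrow> 'v dhypergraph \<Rightarrow> 'n hypermatrix" where
  "in_adj m v H is =
     (\<Sum>(T, D)\<in>edges H. let k = card T in
        if take (m - k) (map v is) \<in> permutations_of_set D
          \<and> drop (m - k) (map v is) \<in> permutations_of_set T
        then 1 / (fact (m - k - 1) * fact k) else 0)"

definition adj :: "nat \<Rightarrow> ('n \<Rightarrow> 'v) \<Rightarrow> 'v dhypergraph \<Rightarrow> 'n hypermatrix" where
  "adj m v H is = out_adj m v H is + in_adj m v H is"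

end

theory Submission
  imports Defs
begin

text \<open>
  The asymmetry between tails and heads disappears once a hypermatrix is applied to a vector.
  If \<open>i\<close> lies in the tail of an edge \<open>e\<close>, then the index lists that start with \<open>i\<close> and match \<open>e\<close>
  in the out-adjacency hypermatrix are as many as the denominator of the entry says, and each of
  them contributes the product of the \<open>x\<^sub>j\<close> over \<open>e - {i}\<close>; if \<open>i\<close> lies in the head, the
  in-adjacency hypermatrix does the same. So the map given by the adjacency hypermatrix is the
  gradient of the edge polynomial, the sum over all edges \<open>e\<close> of the product of the \<open>x\<^sub>j\<close> over \<open>e\<close>
  (lemma \<open>hm_apply_adj\<close>).

  The edge polynomial is homogeneous of degree \<open>m\<close>. By Euler's identity a Z-eigenvalue with
  eigenvector \<open>x\<close> equals \<open>m\<close> times the value of the polynomial at \<open>x\<close>, and a maximiser on the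
  compact unit sphere is an eigenvector by Lagrange's condition
  (lemma \<open>edge_grad_at_max_on_sphere\<close>). Hence, if there is an edge, the largest Z-eigenvalue
  exists and is \<open>m\<close> times the maximum of the edge polynomial on the sphere
  (lemma \<open>max_Z_eigenvalue_adj\<close>). The parts of a partition are nonempty, so this applies to
  every \<open>H\<^sub>i\<close>, and to \<open>H\<close>. The polynomials of the parts of an edge partition add up to the
  polynomial of the whole hypergraph, and the maximum of a sum is at most the sum of the maxima.
\<close>


section \<open>The edge polynomial and its gradient\<close>

definition edge_poly :: "('n \<Rightarrow> 'v) \<Rightarrow> 'v dedge set \<Rightarrow> real ^ 'n::finite \<Rightarrow> real" where
  "edge_poly v E x = (\<Sum>e\<in>E. \<Prod>j\<in>v -` edge_set e. x $ j)"

definition edge_grad :: "('n \<Rightarrow> 'v) \<Rightarrow> 'v dedge set \<Rightarrow> real ^ 'n::finite \<Rightarrow> real ^ 'n" where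
  "edge_grad v E x =
     (\<chi> i. \<Sum>e\<in>E. if v i \<in> edge_set e then \<Prod>j\<in>v -` edge_set e - {i}. x $ j else 0)"

lemma inner_edge_grad:
  fixes v :: "'n::finite \<Rightarrow> 'v"
  shows "y \<bullet> edge_grad v E x =
    (\<Sum>e\<in>E. \<Sum>i\<in>v -` edge_set e. y $ i * (\<Prod>j\<in>v -` edge_set e - {i}. x $ j))"
proof -
  have "y \<bullet> edge_grad v E x =
      (\<Sum>i\<in>UNIV. \<Sum>e\<in>E. if v i \<in> edge_set e
         then y $ i * (\<Prod>j\<in>v -` edge_set e - {i}. x $ j) else 0)"
    by (simp add: edge_grad_def inner_vec_def sum_distrib_left if_distrib cong: if_cong)
  also have "\<dots> = (\<Sum>e\<in>E. \<Sum>i\<in>UNIV. if i \<in> v -` edge_set e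
         then y $ i * (\<Prod>j\<in>v -` edge_set e - {i}. x $ j) else 0)"
    by (subst sum.swap) simp
  also have "\<dots> = (\<Sum>e\<in>E. \<Sum>i\<in>v -` edge_set e. y $ i * (\<Prod>j\<in>v -` edge_set e - {i}. x $ j))"
    by (subst sum.inter_restrict [symmetric]) simp_all
  finally show ?thesis .
qed

text \<open>Euler's identity for the homogeneous edge polynomial.\<close>

lemma inner_self_edge_grad:
  fixes v :: "'n::finite \<Rightarrow> 'v"
  assumes "\<And>e. e \<in> E \<Longrightarrow> card (v -` edge_set e) = m"
  shows "x \<bullet> edge_grad v E x = real m * edge_poly v E x"
proof -
  have "(\<Sum>i\<in>v -` edge_set e. x $ i * (\<Prod>j\<in>v -` edge_set e - {i}. x $ j)) =
      real m * (\<Prod>j\<in>v -` edge_set e. x $ j)" if "e \<in> E" for e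
  proof -
    have "(\<Sum>i\<in>v -` edge_set e. x $ i * (\<Prod>j\<in>v -` edge_set e - {i}. x $ j)) =
        (\<Sum>i\<in>v -` edge_set e. \<Prod>j\<in>v -` edge_set e. x $ j)"
      by (rule sum.cong) (simp_all add: prod.remove [symmetric])
    also have "\<dots> = real m * (\<Prod>j\<in>v -` edge_set e. x $ j)"
      using assms [OF that] by simp
    finally show ?thesis .
  qed
  then show ?thesis
    by (simp add: inner_edge_grad edge_poly_def sum_distrib_left)
qed

lemma has_field_derivative_edge_poly:
  fixes v :: "'n::finite \<Rightarrow> 'v" and c :: "real \<Rightarrow> real ^ 'n"
  assumes "\<And>j. ((\<lambda>t. c t $ j) has_field_derivative d $ j) (at s)"
  shows "((\<lambda>t. edge_poly v E (c t)) has_field_derivative d \<bullet> edge_grad v E (c s)) (at s)"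
  unfolding edge_poly_def inner_edge_grad
  by (intro DERIV_sum has_field_derivative_prod assms)

lemma continuous_on_edge_poly: "continuous_on S (edge_poly v E)"
  unfolding edge_poly_def by (intro continuous_intros)

lemma edge_poly_attains_max_on_sphere:
  fixes v :: "'n::finite \<Rightarrow> 'v"
  obtains x where "norm x = 1" "\<And>y. norm y = 1 \<Longrightarrow> edge_poly v E y \<le> edge_poly v E x"
proof -
  have "axis undefined 1 \<in> sphere (0 :: real ^ 'n) 1"
    by (simp add: norm_axis_1)
  then have "\<exists>x\<in>sphere 0 1. \<forall>y\<in>sphere 0 1. edge_poly v E y \<le> edge_poly v E x"
    by (intro continuous_attains_sup compact_sphere continuous_on_edge_poly) auto
  then show thesis
    using that by auto
qed

text \<open>
  Lagrange's condition, obtained by moving along a great circle: if the gradient had a nonzero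
  component orthogonal to the maximiser, the polynomial would increase in that direction.
\<close>

lemma edge_grad_at_max_on_sphere:
  fixes v :: "'n::finite \<Rightarrow> 'v"
  assumes x: "norm x = 1" and max: "\<And>y. norm y = 1 \<Longrightarrow> edge_poly v E y \<le> edge_poly v E x"
  shows "edge_grad v E x = (x \<bullet> edge_grad v E x) *\<^sub>R x"
proof (rule ccontr)
  define g where "g = edge_grad v E x"
  define w where "w = g - (x \<bullet> g) *\<^sub>R x"
  assume "edge_grad v E x \<noteq> (x \<bullet> edge_grad v E x) *\<^sub>R x"
  then have "w \<noteq> 0"
    by (simp add: w_def g_def)
  have xx: "x \<bullet> x = 1"
    using x by (simp add: norm_eq_1)
  have xw: "x \<bullet> w = 0"
    by (simp add: w_def inner_diff_right xx)
  define y where "y = w /\<^sub>R norm w"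
  have xy: "x \<bullet> y = 0" and yy: "y \<bullet> y = 1"
    using xw \<open>w \<noteq> 0\<close> by (simp_all add: y_def dot_square_norm power2_eq_square)
  define c where "c = (\<lambda>t. cos t *\<^sub>R x + sin t *\<^sub>R y)"
  have "norm (c t) = 1" for t
  proof -
    have "c t \<bullet> c t = (cos t)\<^sup>2 + (sin t)\<^sup>2"
      by (simp add: c_def inner_add_left inner_add_right xx yy xy inner_commute [of y x]
          power2_eq_square)
    then show ?thesis
      by (simp add: norm_eq_1)
  qed
  then have "\<forall>t. \<bar>0 - t\<bar> < 1 \<longrightarrow> edge_poly v E (c t) \<le> edge_poly v E (c 0)"
    using max by (simp add: c_def)
  moreover have "((\<lambda>t. c t $ j) has_field_derivative y $ j) (at 0)" for j
    unfolding c_def by (auto intro!: derivative_eq_intros)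
  then have "((\<lambda>t. edge_poly v E (c t)) has_field_derivative y \<bullet> edge_grad v E (c 0)) (at 0)"
    by (rule has_field_derivative_edge_poly)
  ultimately have "y \<bullet> edge_grad v E (c 0) = 0"
    using DERIV_local_max [of _ _ 0 1] by auto
  then have "w \<bullet> g = 0"
    using \<open>w \<noteq> 0\<close> by (simp add: y_def c_def g_def)
  moreover have "w \<bullet> g = w \<bullet> w"
    using xw by (simp add: w_def inner_diff_right inner_commute)
  ultimately show False
    using \<open>w \<noteq> 0\<close> by simp
qed


section \<open>The adjacency hypermatrix as a gradient\<close>

lemma permutations_of_set_map_iff:
  assumes "inj v" "A \<subseteq> range v"
  shows "map v is \<in> permutations_of_set A \<longleftrightarrow> is \<in> permutations_of_set (v -` A)"
proof -
  have "v ` set is = A \<longleftrightarrow> set is = v -` A"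
    using assms by (metis image_vimage_eq inf.absorb1 inj_vimage_image_eq)
  moreover have "distinct (map v is) \<longleftrightarrow> distinct is"
    using assms(1) by (auto simp: distinct_map intro: inj_on_subset)
  ultimately show ?thesis
    by (simp add: permutations_of_set_def)
qed

text \<open>
  Prefixed with \<open>i\<close>, the lists counted here are the index lists starting with \<open>i\<close> at which an
  adjacency hypermatrix has the entry of an edge; \<open>P\<close> is the side of the edge that is listed first.
\<close>

lemma card_block_permutations_with_head:
  assumes "finite P" "finite Q" "i \<in> P"
  shows "card {is. take (card P) (i # is) \<in> permutations_of_set P \<and>
      drop (card P) (i # is) \<in> permutations_of_set Q} = fact (card P - 1) * fact (card Q)"
    (is "card ?L = _")
proof -
  obtain k where k: "card P = Suc k"
    using assms by (metis card_gt_0_iff empty_iff gr0_conv_Suc)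
  have cons_iff: "i # xs \<in> permutations_of_set P \<longleftrightarrow> xs \<in> permutations_of_set (P - {i})" for xs
    using assms(3) by (auto simp: permutations_of_set_def)
  have len: "length xs = k" if "xs \<in> permutations_of_set (P - {i})" for xs
    using that k assms by (auto simp: permutations_of_set_def distinct_card [symmetric])
  have "?L = (\<lambda>(xs, ys). xs @ ys) ` (permutations_of_set (P - {i}) \<times> permutations_of_set Q)"
  proof (intro equalityI subsetI)
    fix "is"
    assume "is \<in> ?L"
    then have "(take k is, drop k is) \<in> permutations_of_set (P - {i}) \<times> permutations_of_set Q"
      by (simp add: k cons_iff)
    then show "is \<in> (\<lambda>(xs, ys). xs @ ys) ` (permutations_of_set (P - {i}) \<times> permutations_of_set Q)"
      by (rule rev_image_eqI) simp
  next
    fix "is"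
    assume "is \<in> (\<lambda>(xs, ys). xs @ ys) ` (permutations_of_set (P - {i}) \<times> permutations_of_set Q)"
    then show "is \<in> ?L"
      by (auto simp: k cons_iff len)
  qed
  moreover have "inj_on (\<lambda>(xs, ys). xs @ ys)
      (permutations_of_set (P - {i}) \<times> permutations_of_set Q)"
    by (auto simp: inj_on_def) (metis append_eq_append_conv len)+
  ultimately have "card ?L = card (permutations_of_set (P - {i})) * card (permutations_of_set Q)"
    by (simp add: card_image card_cartesian_product)
  then show ?thesis
    using assms by simp
qed

text \<open>
  With \<open>P\<close> the tail and \<open>Q\<close> the head this is the contribution of one edge to the out-adjacency
  hypermatrix, with the roles exchanged its contribution to the in-adjacency hypermatrix. The
  normalising constant of the entry is the reciprocal of the number of matching lists.
\<close>

lemma sum_block_permutations: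
  fixes P Q :: "'n::finite set" and x :: "real ^ 'n"
  assumes m: "m = card P + card Q" and "P \<noteq> {}" and disj: "P \<inter> Q = {}"
  shows "(\<Sum>is | length is = m - 1.
      (if take (card P) (i # is) \<in> permutations_of_set P \<and>
          drop (card P) (i # is) \<in> permutations_of_set Q
       then 1 / (fact (card Q) * fact (card P - 1)) else 0) * (\<Prod>j\<leftarrow>is. x $ j)) =
    (if i \<in> P then \<Prod>j\<in>P \<union> Q - {i}. x $ j else 0)"
    (is "?lhs = _")
proof -
  define L where "L = {is. take (card P) (i # is) \<in> permutations_of_set P \<and>
      drop (card P) (i # is) \<in> permutations_of_set Q}"
  define c :: real where "c = 1 / (fact (card Q) * fact (card P - 1))"
  have "card P > 0"
    using \<open>P \<noteq> {}\<close> by (simp add: card_gt_0_iff)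
  have LD: "i \<in> P \<and> distinct is \<and> set is = P \<union> Q - {i} \<and> length is = m - 1" if "is \<in> L" for "is"
  proof -
    have "set (i # is) = P \<union> Q"
      using that set_append [of "take (card P) (i # is)" "drop (card P) (i # is)"]
      by (simp add: L_def permutations_of_set_def del: set_append)
    moreover have dist: "distinct (i # is)"
      using that distinct_append [of "take (card P) (i # is)" "drop (card P) (i # is)"] disj
      by (simp add: L_def permutations_of_set_def del: distinct_append)
    moreover have "i \<in> P"
      using that \<open>card P > 0\<close> by (cases "card P") (auto simp: L_def permutations_of_set_def)
    moreover have "length (i # is) = m"
      using distinct_card [OF dist] calculation(1) m disj by (simp add: card_Un_disjoint)
    ultimately show ?thesis
      by auto
  qed
  have "?lhs = (\<Sum>is\<in>L. c * (\<Prod>j\<leftarrow>is. x $ j))"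
  proof (rule sum.mono_neutral_cong_right)
    show "finite {is :: 'n list. length is = m - 1}"
      using finite_lists_length_eq [of "UNIV :: 'n set"] by simp
    show "L \<subseteq> {is. length is = m - 1}"
      using LD by blast
  qed (auto simp: L_def c_def)
  also have "\<dots> = (\<Sum>is\<in>L. c * (\<Prod>j\<in>P \<union> Q - {i}. x $ j))"
  proof (rule sum.cong [OF refl])
    fix "is"
    assume "is \<in> L"
    then have "(\<Prod>j\<leftarrow>is. x $ j) = (\<Prod>j\<in>P \<union> Q - {i}. x $ j)"
      using LD by (metis prod.distinct_set_conv_list)
    then show "c * (\<Prod>j\<leftarrow>is. x $ j) = c * (\<Prod>j\<in>P \<union> Q - {i}. x $ j)"
      by simp
  qed
  also have "\<dots> = real (card L) * c * (\<Prod>j\<in>P \<union> Q - {i}. x $ j)"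
    by simp
  also have "\<dots> = (if i \<in> P then \<Prod>j\<in>P \<union> Q - {i}. x $ j else 0)"
  proof (cases "i \<in> P")
    case True
    then have "card L = fact (card P - 1) * fact (card Q)"
      unfolding L_def by (intro card_block_permutations_with_head) simp_all
    then show ?thesis
      using True by (simp add: c_def)
  next
    case False
    then have "L = {}"
      using LD by blast
    then show ?thesis
      using False by simp
  qed
  finally show ?thesis .
qed

lemma dhypergraph_edgeD:
  assumes "dhypergraph H" "(T, D) \<in> edges H"
  shows "T \<noteq> {}" "D \<noteq> {}" "T \<inter> D = {}" "T \<union> D \<subseteq> verts H"
  using assms by (auto simp: dhypergraph_def)

lemma finite_edges:
  assumes "dhypergraph H"
  shows "finite (edges H)"
proof (rule finite_subset)
  show "edges H \<subseteq> Pow (verts H) \<times> Pow (verts H)"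
    using dhypergraph_edgeD(4) [OF assms] by auto
  show "finite (Pow (verts H) \<times> Pow (verts H))"
    using assms by (simp add: dhypergraph_def)
qed

lemma card_vimage_edge_set:
  assumes "uniform_dhypergraph m H" "bij_betw v UNIV (verts H)" "e \<in> edges H"
  shows "card (v -` edge_set e) = m"
proof -
  have "edge_set e \<subseteq> range v"
    using assms
    by (cases e) (auto simp: uniform_dhypergraph_def edge_set_def bij_betw_def
        dest: dhypergraph_edgeD)
  then show ?thesis
    using assms by (simp add: card_vimage_inj bij_betw_def uniform_dhypergraph_def)
qed

lemma hm_apply_add:
  "hm_apply m (\<lambda>is. A is + B is) x = hm_apply m A x + hm_apply m B x"
  by (simp add: hm_apply_def vec_eq_iff distrib_right sum.distrib)

lemma hm_apply_sum:
  "hm_apply m (\<lambda>is. \<Sum>e\<in>E. A e is) x = (\<Sum>e\<in>E. hm_apply m (A e) x)"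
proof -
  have "hm_apply m (\<lambda>is. \<Sum>e\<in>E. A e is) x $ i = (\<Sum>e\<in>E. hm_apply m (A e) x) $ i" for i
    by (simp add: hm_apply_def sum_distrib_right) (rule sum.swap)
  then show ?thesis
    by (simp add: vec_eq_iff)
qed

text \<open>
  An index in the tail of an edge sees the edge through the out-adjacency hypermatrix only, an index
  in its head through the in-adjacency hypermatrix only; so no edge is counted twice.
\<close>

lemma hm_apply_adj:
  fixes v :: "'n::finite \<Rightarrow> 'v"
  assumes unif: "uniform_dhypergraph m H" and bij: "bij_betw v UNIV (verts H)"
  shows "hm_apply m (adj m v H) x = edge_grad v (edges H) x"
proof -
  define out where "out = (\<lambda>(T, D) is. let k = card T in
        if take k (map v is) \<in> permutations_of_set T \<and> drop k (map v is) \<in> permutations_of_set D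
        then 1 / (fact (m - k) * fact (k - 1)) else (0::real))"
  define inn where "inn = (\<lambda>(T, D) is. let k = card T in
        if take (m - k) (map v is) \<in> permutations_of_set D
          \<and> drop (m - k) (map v is) \<in> permutations_of_set T
        then 1 / (fact (m - k - 1) * fact k) else (0::real))"
  have edge: "hm_apply m (out e) x $ i + hm_apply m (inn e) x $ i =
      (if v i \<in> edge_set e then \<Prod>j\<in>v -` edge_set e - {i}. x $ j else 0)"
    if e: "e \<in> edges H" for e i
  proof -
    obtain T D where TD: "e = (T, D)"
      by (cases e)
    have H: "dhypergraph H" "card (T \<union> D) = m"
      using unif e by (auto simp: uniform_dhypergraph_def edge_set_def TD)
    note TD_props = dhypergraph_edgeD [OF H(1) e [unfolded TD]]
    have "inj v" and ran: "T \<subseteq> range v" "D \<subseteq> range v"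
      using bij TD_props(4) by (auto simp: bij_betw_def)
    note perm_iff = permutations_of_set_map_iff [OF \<open>inj v\<close> ran(1)]
      permutations_of_set_map_iff [OF \<open>inj v\<close> ran(2)]
    define P Q where "P = v -` T" and "Q = v -` D"
    have card: "card T = card P" "card D = card Q"
      using \<open>inj v\<close> ran by (simp_all add: P_def Q_def card_vimage_inj)
    have PQ: "P \<noteq> {}" "Q \<noteq> {}" "P \<inter> Q = {}"
      using TD_props(1-3) ran by (fastforce simp: P_def Q_def)+
    have "finite T" "finite D"
      using H(1) TD_props(4) by (auto simp: dhypergraph_def intro: finite_subset)
    then have m: "m = card P + card Q"
      using H(2) TD_props(3) card by (simp add: card_Un_disjoint)
    have sizes: "m - card P = card Q" and m': "m = card Q + card P"
      using m by simp_all
    have "out e is = (if take (card P) is \<in> permutations_of_set P \<and>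
          drop (card P) is \<in> permutations_of_set Q
        then 1 / (fact (card Q) * fact (card P - 1)) else 0)" for "is"
      unfolding out_def TD Let_def prod.case take_map drop_map perm_iff card sizes
        P_def [symmetric] Q_def [symmetric]
      by (rule refl)
    then have "hm_apply m (out e) x $ i = (if i \<in> P then \<Prod>j\<in>P \<union> Q - {i}. x $ j else 0)"
      using sum_block_permutations [OF m PQ(1) PQ(3), of i x]
      by (simp only: hm_apply_def vec_lambda_beta)
    moreover have "inn e is = (if take (card Q) is \<in> permutations_of_set Q \<and>
          drop (card Q) is \<in> permutations_of_set P
        then 1 / (fact (card P) * fact (card Q - 1)) else 0)" for "is"
      unfolding inn_def TD Let_def prod.case take_map drop_map perm_iff card sizes
        P_def [symmetric] Q_def [symmetric]
      by (simp only: mult.commute [of "fact (card Q - 1)"])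
    then have "hm_apply m (inn e) x $ i = (if i \<in> Q then \<Prod>j\<in>Q \<union> P - {i}. x $ j else 0)"
      using sum_block_permutations [OF m' PQ(2), of i x] PQ(3)
      by (simp only: hm_apply_def vec_lambda_beta Int_commute [of Q P])
    moreover have "v -` edge_set e = P \<union> Q"
      by (auto simp: edge_set_def TD P_def Q_def)
    moreover have "v i \<in> edge_set e \<longleftrightarrow> i \<in> P \<or> i \<in> Q"
      by (simp add: edge_set_def TD P_def Q_def)
    ultimately show ?thesis
      using PQ(3) by (auto simp: Un_commute)
  qed
  have "adj m v H = (\<lambda>is. (\<Sum>e\<in>edges H. out e is) + (\<Sum>e\<in>edges H. inn e is))"
    by (simp add: fun_eq_iff adj_def out_adj_def in_adj_def out_def inn_def case_prod_unfold)
  then have "hm_apply m (adj m v H) x $ i =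
      (\<Sum>e\<in>edges H. hm_apply m (out e) x $ i + hm_apply m (inn e) x $ i)" for i
    by (simp add: hm_apply_add hm_apply_sum sum.distrib)
  moreover have "(\<Sum>e\<in>edges H. hm_apply m (out e) x $ i + hm_apply m (inn e) x $ i) =
      edge_grad v (edges H) x $ i" for i
    unfolding edge_grad_def vec_lambda_beta by (intro sum.cong refl edge)
  ultimately show ?thesis
    by (simp add: vec_eq_iff)
qed


section \<open>The largest Z-eigenvalue\<close>

lemma nonzero_hypermatrix_adj:
  fixes v :: "'n::finite \<Rightarrow> 'v"
  assumes unif: "uniform_dhypergraph m H" and bij: "bij_betw v UNIV (verts H)"
    and "edges H \<noteq> {}"
  shows "nonzero_hypermatrix m (adj m v H)"
proof -
  \<comment> \<open>At the all-ones vector the gradient has a positive entry at every vertex of an edge.\<close>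
  obtain e where e: "e \<in> edges H"
    using assms by blast
  define x :: "real ^ 'n" where "x = (\<chi> i. 1)"
  have H: "dhypergraph H"
    using unif by (simp add: uniform_dhypergraph_def)
  have "fst e \<noteq> {}" "fst e \<subseteq> range v"
    using dhypergraph_edgeD [OF H, of "fst e" "snd e"] e bij by (simp_all add: bij_betw_def)
  then obtain i where i: "v i \<in> edge_set e"
    by (auto simp: edge_set_def)
  have "hm_apply m (adj m v H) x $ i = (\<Sum>e\<in>edges H. if v i \<in> edge_set e then 1 else 0)"
    unfolding hm_apply_adj [OF unif bij] by (simp add: edge_grad_def x_def cong: if_cong)
  also have "\<dots> > 0"
    using finite_edges [OF H] e i by (intro sum_pos2 [of _ e]) auto
  finally have "(\<Sum>is | length is = m - 1. adj m v H (i # is) * (\<Prod>j\<leftarrow>is. x $ j)) \<noteq> 0"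
    by (simp add: hm_apply_def)
  then obtain "is" where "length is = m - 1" "adj m v H (i # is) \<noteq> 0"
    by (auto elim!: sum.not_neutral_contains_not_neutral)
  moreover have "card (v -` edge_set e) > 0"
    using i by (auto simp: card_gt_0_iff)
  then have "m > 0"
    using card_vimage_edge_set [OF unif bij e] by simp
  ultimately have "length (i # is) = m" "adj m v H (i # is) \<noteq> 0"
    by auto
  then show ?thesis
    unfolding nonzero_hypermatrix_def by blast
qed

text \<open>
  The variational characterisation of the largest Z-eigenvalue: every Z-eigenvalue is a value of
  \<open>m\<close> times the edge polynomial on the unit sphere by Euler's identity, and the maximum of these
  values is a Z-eigenvalue by Lagrange's condition. An edge is needed because the zero hypermatrix
  has no Z-eigenpairs.
\<close>

lemma max_Z_eigenvalue_adj:
  fixes v :: "'n::finite \<Rightarrow> 'v"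
  assumes unif: "uniform_dhypergraph m H" and bij: "bij_betw v UNIV (verts H)"
    and ne: "edges H \<noteq> {}"
    and x: "norm x = 1"
    and max: "\<And>y. norm y = 1 \<Longrightarrow> edge_poly v (edges H) y \<le> edge_poly v (edges H) x"
  shows "max_Z_eigenvalue m (adj m v H) = real m * edge_poly v (edges H) x"
proof -
  have euler: "y \<bullet> edge_grad v (edges H) y = real m * edge_poly v (edges H) y" for y
    using card_vimage_edge_set [OF unif bij] by (rule inner_self_edge_grad)
  have norm_1: "(\<Sum>i\<in>UNIV. (y $ i)\<^sup>2) = 1 \<longleftrightarrow> norm y = 1" for y :: "real ^ 'n"
    by (simp add: norm_eq_1 inner_vec_def power2_eq_square)
  show ?thesis
    unfolding max_Z_eigenvalue_def
  proof (rule Greatest_equality)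
    have "hm_apply m (adj m v H) x = (real m * edge_poly v (edges H) x) *\<^sub>R x"
      using edge_grad_at_max_on_sphere [OF x max] by (simp add: hm_apply_adj [OF unif bij] euler)
    moreover have "x \<noteq> 0"
      using x by auto
    ultimately have "Z_eigenpair m (adj m v H) (real m * edge_poly v (edges H) x) x"
      using nonzero_hypermatrix_adj [OF unif bij ne] x by (simp add: Z_eigenpair_def norm_1)
    then show "Z_eigenvalue m (adj m v H) (real m * edge_poly v (edges H) x)"
      unfolding Z_eigenvalue_def by blast
  next
    fix l
    assume "Z_eigenvalue m (adj m v H) l"
    then obtain y where y: "edge_grad v (edges H) y = l *\<^sub>R y" "norm y = 1"
      by (auto simp: Z_eigenvalue_def Z_eigenpair_def norm_1 hm_apply_adj [OF unif bij])
    then have "l = real m * edge_poly v (edges H) y"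
      using euler [of y] by (simp add: norm_eq_1)
    also have "\<dots> \<le> real m * edge_poly v (edges H) x"
      using max [OF y(2)] by (simp add: mult_left_mono)
    finally show "l \<le> real m * edge_poly v (edges H) x" .
  qed
qed

theorem theorem8:
  fixes H :: "'v dhypergraph"
    and Hs :: "nat \<Rightarrow> 'v dhypergraph"
    and v :: "'n::finite \<Rightarrow> 'v"
    and m p :: nat
  assumes "uniform_dhypergraph m H"
    and "bij_betw v UNIV (verts H)"
    and "p \<ge> 1"
    and "\<forall>i\<in>{1..p}. spanning_subhypergraph (Hs i) H"
    and "inj_on (\<lambda>i. edges (Hs i)) {1..p}"
    and "partition_on (edges H) ((\<lambda>i. edges (Hs i)) ` {1..p})"
  shows "max_Z_eigenvalue m (adj m v H) \<le> (\<Sum>i=1..p. max_Z_eigenvalue m (adj m v (Hs i)))"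
proof -
  let ?F = "\<lambda>G. edge_poly v (edges G)"
  have Un: "edges H = (\<Union>i\<in>{1..p}. edges (Hs i))"
    and ne: "\<And>i. i \<in> {1..p} \<Longrightarrow> edges (Hs i) \<noteq> {}"
    and disj: "disjoint ((\<lambda>i. edges (Hs i)) ` {1..p})"
    using assms(6) by (auto simp: partition_on_def)
  have ne_H: "edges H \<noteq> {}"
    using Un ne [of 1] assms(3) by fastforce
  have unif: "uniform_dhypergraph m (Hs i)" and bij: "bij_betw v UNIV (verts (Hs i))"
    if "i \<in> {1..p}" for i
  proof -
    have "spanning_subhypergraph (Hs i) H"
      using that assms(4) by blast
    then show "uniform_dhypergraph m (Hs i)" "bij_betw v UNIV (verts (Hs i))"
      using assms(1,2) by (auto simp: uniform_dhypergraph_def spanning_subhypergraph_def)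
  qed
  have F_sum: "?F H x = (\<Sum>i=1..p. ?F (Hs i) x)" for x
    unfolding edge_poly_def Un
  proof (rule sum.UNION_disjoint)
    show "\<forall>i\<in>{1..p}. finite (edges (Hs i))"
      using unif by (auto simp: uniform_dhypergraph_def intro: finite_edges)
    show "\<forall>i\<in>{1..p}. \<forall>j\<in>{1..p}. i \<noteq> j \<longrightarrow> edges (Hs i) \<inter> edges (Hs j) = {}"
    proof (intro ballI impI)
      fix i j
      assume "i \<in> {1..p}" "j \<in> {1..p}" "i \<noteq> j"
      then show "edges (Hs i) \<inter> edges (Hs j) = {}"
        using inj_onD [OF assms(5)] by (intro disjointD [OF disj]) blast+
    qed
  qed simp
  obtain x where x: "norm x = 1" "\<And>y. norm y = 1 \<Longrightarrow> ?F H y \<le> ?F H x"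
    using edge_poly_attains_max_on_sphere [of v "edges H"] by metis
  have "max_Z_eigenvalue m (adj m v H) = real m * ?F H x"
    by (rule max_Z_eigenvalue_adj [OF assms(1,2) ne_H x])
  also have "\<dots> = (\<Sum>i=1..p. real m * ?F (Hs i) x)"
    by (simp add: F_sum sum_distrib_left)
  also have "\<dots> \<le> (\<Sum>i=1..p. max_Z_eigenvalue m (adj m v (Hs i)))"
  proof (rule sum_mono)
    fix i
    assume i: "i \<in> {1..p}"
    obtain z where z: "norm z = 1" "\<And>y. norm y = 1 \<Longrightarrow> ?F (Hs i) y \<le> ?F (Hs i) z"
      using edge_poly_attains_max_on_sphere [of v "edges (Hs i)"] by metis
    have "real m * ?F (Hs i) x \<le> real m * ?F (Hs i) z"
      using z(2) [OF x(1)] by (simp add: mult_left_mono)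
    then show "real m * ?F (Hs i) x \<le> max_Z_eigenvalue m (adj m v (Hs i))"
      by (simp add: max_Z_eigenvalue_adj [OF unif [OF i] bij [OF i] ne [OF i] z])
  qed
  finally show ?thesis .
qed

end
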